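(* Consider the cryptographic Byzantine causal reliable broadcast protocol described in the context, which uses an $(n-f,n)$ threshold decryption scheme. Then a Byzantine process cannot decrypt or learn the plaintext content of any message $m$ broadcast by a correct process before $m$ has been BRB-delivered by at least $n-2f$ correct processes.
   Context: System: an asynchronous system of $n$ processes $p_1,\dots,p_n$, of which at most $f$ are Byzantine (they may behave arbitrarily and collude), with $n\ge 3f+1$; the others are correct. Processes communicate over reliable authenticated point-to-point FIFO channels. There is a Byzantine Reliable Broadcast (BRB) primitive with operations brb_broadcast and brb_deliver; "BRB-delivered by $p$" means that brb_deliver has occurred at $p$. Threshold scheme: there is a public encryption key $PK$, and each process $p_i$ holds a secret key share $SK_i$ with which it can compute its own decryption share of a ciphertext. In an $(n-f,n)$ threshold decryption scheme, a ciphertext can be decrypted (its plaintext content can be learned) only once at least $n-f$ valid decryption shares from distinct processes have been collected. All Byzantine processes together hold at most $f$ key shares. Protocol (relevant part): to broadcast a payload, a correct process encrypts it under $PK$ and invokes brb_broadcast on the ciphertext. A correct process computes its decryption share of a ciphertext and broadcasts this share (inside an acknowledgment sent to all) only upon BRB-delivering that ciphertext. *)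

theory Defs
  imports Main "HOL-Library.Sublist"
begin

text \<open>
  A symbolic (Dolev--Yao) model of the protocol. Processes \<open>p\<^sub>1, \<dots>, p\<^sub>n\<close> are the numbers
  \<open>1, \<dots>, n\<close>. A message is identified by its origin \<open>p\<close> and a sequence number \<open>k\<close>; its plaintext
  is the opaque atom \<open>Content p k\<close>, initially known to \<open>p\<close> only. Cryptography is perfect: terms
  can be taken apart and built only by the rules of \<open>deduce\<close> below.
\<close>

type_synonym proc = nat

datatype msg =
    Data nat               \<comment> \<open>public data: headers, identifiers, control information\<close>
  | Content proc nat
  | KeyShare proc          \<comment> \<open>\<open>SK\<^sub>i\<close>\<close>
  | Enc nat msg            \<comment> \<open>encryption under \<open>PK\<close>; the number is the encryption randomness\<close>
  | DecShare proc msg      \<comment> \<open>the valid decryption share of process \<open>i\<close> for a ciphertext\<close>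
  | MPair msg msg

text \<open>
  What can be computed from the terms in \<open>H\<close> when a \<open>(t, n)\<close> threshold decryption scheme is
  used. As \<open>PK\<close> is public, encryption needs no key in \<open>H\<close>.
\<close>

inductive_set deduce :: "nat \<Rightarrow> nat \<Rightarrow> msg set \<Rightarrow> msg set"
  for t n :: nat and H :: "msg set" where
  Obs: "x \<in> H \<Longrightarrow> x \<in> deduce t n H"
| Public: "Data d \<in> deduce t n H"
| Pairing: "\<lbrakk>x \<in> deduce t n H; y \<in> deduce t n H\<rbrakk> \<Longrightarrow> MPair x y \<in> deduce t n H"
| Left: "MPair x y \<in> deduce t n H \<Longrightarrow> x \<in> deduce t n H"
| Right: "MPair x y \<in> deduce t n H \<Longrightarrow> y \<in> deduce t n H"
| Encrypt: "x \<in> deduce t n H \<Longrightarrow> Enc r x \<in> deduce t n H"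
| Share: "\<lbrakk>KeyShare i \<in> deduce t n H; Enc r x \<in> deduce t n H\<rbrakk>
    \<Longrightarrow> DecShare i (Enc r x) \<in> deduce t n H"
| Decrypt: "\<lbrakk>Enc r x \<in> deduce t n H; S \<subseteq> {1..n}; t \<le> card S;
      \<forall>i\<in>S. DecShare i (Enc r x) \<in> deduce t n H\<rbrakk> \<Longrightarrow> x \<in> deduce t n H"

datatype event =
    BRB_Broadcast proc nat msg       \<comment> \<open>\<open>brb_broadcast\<close> by an origin, with sequence number\<close>
  | BRB_Deliver proc proc nat msg    \<comment> \<open>\<open>brb_deliver\<close> at a process, for an origin and its sequence number\<close>
  | Send proc proc msg               \<comment> \<open>sender, receiver\<close>
  | Recv proc proc msg               \<comment> \<open>receiver, sender\<close>

definition sent :: "event list \<Rightarrow> proc \<Rightarrow> proc \<Rightarrow> msg list" where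
  "sent tr p q = [x. Send p' q' x \<leftarrow> tr, p' = p \<and> q' = q]"

definition received :: "event list \<Rightarrow> proc \<Rightarrow> proc \<Rightarrow> msg list" where
  "received tr q p = [x. Recv q' p' x \<leftarrow> tr, q' = q \<and> p' = p]"

text \<open>
  BRB gives no confidentiality: whatever is BRB-broadcast is visible to all processes at once.
\<close>

definition view :: "event list \<Rightarrow> proc \<Rightarrow> msg set" where
  "view tr p = {KeyShare p} \<union> range (Content p)
     \<union> {x. \<exists>q. Recv p q x \<in> set tr}
     \<union> {c. \<exists>q k. BRB_Broadcast q k c \<in> set tr}
     \<union> {c. \<exists>q k. BRB_Deliver p q k c \<in> set tr}"

text \<open>Byzantine processes collude, so each of them has the views of all of them at its disposal.\<close>

definition knowledge :: "nat \<Rightarrow> nat \<Rightarrow> proc set \<Rightarrow> event list \<Rightarrow> proc \<Rightarrow> msg set" where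
  "knowledge n f Byz tr p =
     deduce (n - f) n (\<Union>q\<in>(if p \<in> Byz then Byz else {p}). view tr q)"

definition can_decrypt :: "nat \<Rightarrow> nat \<Rightarrow> proc set \<Rightarrow> event list \<Rightarrow> proc \<Rightarrow> msg \<Rightarrow> bool" where
  "can_decrypt n f Byz tr p c \<longleftrightarrow>
     (\<exists>S \<subseteq> {1..n}. n - f \<le> card S \<and> (\<forall>i\<in>S. DecShare i c \<in> knowledge n f Byz tr p))"

text \<open>
  Whatever the claimed origin: a decryption share depends on the ciphertext alone, and a correct
  process releases it upon delivery of that ciphertext in any BRB instance.
\<close>

definition brb_delivered :: "event list \<Rightarrow> proc \<Rightarrow> msg \<Rightarrow> bool" where
  "brb_delivered tr p c \<longleftrightarrow> (\<exists>q k. BRB_Deliver p q k c \<in> set tr)"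

text \<open>
  Finite executions, in chronological order. The guards of \<open>DeliverCorrect\<close> and \<open>DeliverByz\<close> are
  the safety properties of BRB: integrity, no duplication and consistency. A Byzantine origin may
  have anything BRB-delivered that the coalition can compute, including a copy of somebody else's
  ciphertext. Channels are authenticated because a process only sends under its own identity.
  \<open>Control\<close> stands for all other traffic of correct processes, none of which carries secrets; their
  decryption and causal delivery of messages are local and leave no event. Liveness (reliability of
  channels, termination of BRB) does not constrain finite executions.
\<close>

inductive_set runs :: "nat \<Rightarrow> nat \<Rightarrow> proc set \<Rightarrow> event list set"
  for n f :: nat and Byz :: "proc set" where
  Empty: "[] \<in> runs n f Byz"
| Broadcast: "\<lbrakk>tr \<in> runs n f Byz; p \<in> {1..n} - Byz; \<nexists>c. BRB_Broadcast p k c \<in> set tr\<rbrakk>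
    \<Longrightarrow> tr @ [BRB_Broadcast p k (Enc r (Content p k))] \<in> runs n f Byz"
| DeliverCorrect: "\<lbrakk>tr \<in> runs n f Byz; p \<in> {1..n} - Byz; q \<in> {1..n} - Byz;
      BRB_Broadcast q k c \<in> set tr; \<nexists>c'. BRB_Deliver p q k c' \<in> set tr\<rbrakk>
    \<Longrightarrow> tr @ [BRB_Deliver p q k c] \<in> runs n f Byz"
| DeliverByz: "\<lbrakk>tr \<in> runs n f Byz; p \<in> {1..n} - Byz; q \<in> Byz;
      c \<in> knowledge n f Byz tr q; \<nexists>c'. BRB_Deliver p q k c' \<in> set tr;
      \<forall>p' c'. BRB_Deliver p' q k c' \<in> set tr \<longrightarrow> c' = c\<rbrakk>
    \<Longrightarrow> tr @ [BRB_Deliver p q k c] \<in> runs n f Byz"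
| Ack: "\<lbrakk>tr \<in> runs n f Byz; p \<in> {1..n} - Byz; q \<in> {1..n}; brb_delivered tr p (Enc r x)\<rbrakk>
    \<Longrightarrow> tr @ [Send p q (MPair (Data d) (DecShare p (Enc r x)))] \<in> runs n f Byz"
| Control: "\<lbrakk>tr \<in> runs n f Byz; p \<in> {1..n} - Byz; q \<in> {1..n}\<rbrakk>
    \<Longrightarrow> tr @ [Send p q (Data d)] \<in> runs n f Byz"
| SendByz: "\<lbrakk>tr \<in> runs n f Byz; b \<in> Byz; q \<in> {1..n}; x \<in> knowledge n f Byz tr b\<rbrakk>
    \<Longrightarrow> tr @ [Send b q x] \<in> runs n f Byz"
| Receive: "\<lbrakk>tr \<in> runs n f Byz; p \<in> {1..n}; q \<in> {1..n};
      prefix (received tr q p @ [x]) (sent tr p q)\<rbrakk>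
    \<Longrightarrow> tr @ [Recv q p x] \<in> runs n f Byz"

end

theory Submission
  imports Defs
begin

text \<open>
  Let \<open>A\<close> consist of the Byzantine processes and the correct processes that have delivered \<open>c\<close>. If
  \<open>A\<close> has fewer than \<open>n - f\<close> members, then no term in circulation exposes \<open>Content p k\<close> outside of
  \<open>c\<close>, or is a decryption share of \<open>c\<close> by a process outside of \<open>A\<close>. This is preserved by
  deduction, because decrypting \<open>c\<close> would take \<open>n - f\<close> shares, all from \<open>A\<close>; and it is preserved
  by every step of a run, because correct processes release shares of \<open>c\<close> only after delivering it
  and broadcast \<open>Content p k\<close> only inside \<open>c\<close>. Hence decrypting \<open>c\<close> requires
  \<open>n - f \<le> card A \<le> f + card (A - Byz)\<close>.
\<close>

text \<open>The \<open>KeyShare\<close> clause makes the invariant stable under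
  \<open>Share\<close>: only members of \<open>A\<close> can produce shares of \<open>c\<close>. The
  \<open>DecShare\<close> clause ignores what \<open>x\<close> contains, since
  \<open>Decrypt\<close> also needs the ciphertext itself.\<close>

fun guarded :: "proc set \<Rightarrow> proc \<Rightarrow> nat \<Rightarrow> msg \<Rightarrow> msg \<Rightarrow> bool" where
  "guarded A p k c (Data d) \<longleftrightarrow> True"
| "guarded A p k c (Content q j) \<longleftrightarrow> (q, j) \<noteq> (p, k)"
| "guarded A p k c (KeyShare i) \<longleftrightarrow> i \<in> A"
| "guarded A p k c (Enc r x) \<longleftrightarrow> guarded A p k c x \<or> Enc r x = c"
| "guarded A p k c (DecShare i x) \<longleftrightarrow> (x = c \<longrightarrow> i \<in> A)"
| "guarded A p k c (MPair x y) \<longleftrightarrow> guarded A p k c x \<and> guarded A p k c y"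

lemma guarded_deduce:
  assumes "x \<in> deduce t n H" and "\<And>y. y \<in> H \<Longrightarrow> guarded A p k c y"
    and "finite A" and "card A < t"
  shows "guarded A p k c x"
  using assms(1)
proof induction
  case (Decrypt r x S)
  show ?case
  proof (rule ccontr)
    assume "\<not> guarded A p k c x"
    \<comment> \<open>\<open>Enc r x\<close> is guarded but \<open>x\<close> is not, so
      \<open>Enc r x\<close> is \<open>c\<close>, and the guarded shares indexed by \<open>S\<close>
      are shares of \<open>c\<close>.\<close>
    with Decrypt have "S \<subseteq> A" by auto
    with assms(3) have "card S \<le> card A" by (rule card_mono)
    with Decrypt.hyps assms(4) show False by simp
  qed
qed (use assms(2) in auto)

fun payload :: "event \<Rightarrow> msg" where
  "payload (BRB_Broadcast p k x) = x"
| "payload (BRB_Deliver p q k x) = x"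
| "payload (Send p q x) = x"
| "payload (Recv p q x) = x"

text \<open>Besides payloads of events, the coalition starts from its own key shares, which are
  guarded as \<open>Byz\<close> lies in \<open>A\<close>, and its own contents, whose origin differs
  from \<open>p\<close>.\<close>

lemma guarded_knowledge:
  assumes "x \<in> knowledge n f Byz tr b" and "b \<in> Byz" and "Byz \<subseteq> A" and "p \<notin> Byz"
    and "finite A" and "card A < n - f"
    and "\<And>e. e \<in> set tr \<Longrightarrow> guarded A p k c (payload e)"
  shows "guarded A p k c x"
proof (rule guarded_deduce)
  show "x \<in> deduce (n - f) n (\<Union>q\<in>Byz. view tr q)"
    using assms(1,2) by (simp add: knowledge_def)
  show "guarded A p k c y" if "y \<in> (\<Union>q\<in>Byz. view tr q)" for y
    using that assms(3,4) by (auto simp: view_def dest: assms(7))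
qed (use assms in auto)

lemma received_was_sent:
  assumes "prefix (received tr q p @ [x]) (sent tr p q)"
  shows "Send p q x \<in> set tr"
proof -
  have "x \<in> set (sent tr p q)"
    using set_mono_prefix[OF assms] by simp
  then show ?thesis
    by (auto simp: sent_def split: event.splits if_splits)
qed

text \<open>The hypotheses on broadcasts and deliveries pass to shorter runs, so one fixed
  \<open>A\<close> containing all deliverers of \<open>c\<close> in the whole run serves throughout
  the induction.\<close>

lemma guarded_runs:
  assumes "tr \<in> runs n f Byz"
    and "Byz \<subseteq> A" and "p \<notin> Byz" and "finite A" and "card A < n - f"
    and "\<And>c'. BRB_Broadcast p k c' \<in> set tr \<Longrightarrow> c' = c"
    and "\<And>q. brb_delivered tr q c \<Longrightarrow> q \<in> A"
    and "e \<in> set tr"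
  shows "guarded A p k c (payload e)"
  using assms(1,6-8)
proof (induction arbitrary: e)
  case Empty
  then show ?case by simp
next
  case (Broadcast tr q j r)
  have IH: "guarded A p k c (payload e)" if "e \<in> set tr" for e
    using Broadcast.prems(1,2) that by (intro Broadcast.IH) (auto simp: brb_delivered_def)
  \<comment> \<open>Either \<open>(q, j)\<close> differs from \<open>(p, k)\<close>, or the new
    ciphertext is \<open>c\<close> by the hypothesis on broadcasts.\<close>
  have "guarded A p k c (Enc r (Content q j))"
    using Broadcast.prems(1)[of "Enc r (Content q j)"] by auto
  with IH Broadcast.prems(3) show ?case by auto
next
  case (DeliverCorrect tr p' q j c')
  have IH: "guarded A p k c (payload e)" if "e \<in> set tr" for e
    using DeliverCorrect.prems(1,2) that
    by (intro DeliverCorrect.IH) (auto simp: brb_delivered_def)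
  from IH[OF DeliverCorrect.hyps(4)] IH DeliverCorrect.prems(3) show ?case by auto
next
  case (DeliverByz tr p' q c' j)
  have IH: "guarded A p k c (payload e)" if "e \<in> set tr" for e
    using DeliverByz.prems(1,2) that by (intro DeliverByz.IH) (auto simp: brb_delivered_def)
  have "guarded A p k c c'"
    using guarded_knowledge[OF DeliverByz.hyps(4,3) assms(2-5) IH] by simp
  with IH DeliverByz.prems(3) show ?case by auto
next
  case (Ack tr p' q r x d)
  have IH: "guarded A p k c (payload e)" if "e \<in> set tr" for e
    using Ack.prems(1,2) that by (intro Ack.IH) (auto simp: brb_delivered_def)
  have "p' \<in> A" if "Enc r x = c"
    using Ack.prems(2)[of p'] Ack.hyps(4) that by (auto simp: brb_delivered_def)
  with IH Ack.prems(3) show ?case by auto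
next
  case (Control tr p' q d)
  have IH: "guarded A p k c (payload e)" if "e \<in> set tr" for e
    using Control.prems(1,2) that by (intro Control.IH) (auto simp: brb_delivered_def)
  with Control.prems(3) show ?case by auto
next
  case (SendByz tr b q x)
  have IH: "guarded A p k c (payload e)" if "e \<in> set tr" for e
    using SendByz.prems(1,2) that by (intro SendByz.IH) (auto simp: brb_delivered_def)
  have "guarded A p k c x"
    using guarded_knowledge[OF SendByz.hyps(4,2) assms(2-5) IH] by simp
  with IH SendByz.prems(3) show ?case by auto
next
  case (Receive tr p' q x)
  have IH: "guarded A p k c (payload e)" if "e \<in> set tr" for e
    using Receive.prems(1,2) that by (intro Receive.IH) (auto simp: brb_delivered_def)
  from IH[OF received_was_sent[OF Receive.hyps(4)]] IH Receive.prems(3) show ?case by auto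
qed

lemma runs_prefix_closed:
  assumes "tr \<in> runs n f Byz" and "prefix tr' tr"
  shows "tr' \<in> runs n f Byz"
  using assms
  by (induction rule: runs.induct) (auto intro: runs.intros)

lemma broadcast_unique:
  assumes "tr \<in> runs n f Byz"
    and "BRB_Broadcast p k c \<in> set tr" and "BRB_Broadcast p k c' \<in> set tr"
  shows "c' = c"
  using assms by (induction rule: runs.induct) auto

theorem theorem5p1:
  fixes n f :: nat and Byz :: "proc set" and tr tr' :: "event list"
    and p b :: proc and k :: nat and c :: msg
  assumes "n \<ge> 3 * f + 1"
    and "Byz \<subseteq> {1..n}" and "card Byz \<le> f"
    and "tr \<in> runs n f Byz"
    and "p \<in> {1..n} - Byz" and "BRB_Broadcast p k c \<in> set tr"
    and "b \<in> Byz"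
    and "prefix tr' tr"
    and "can_decrypt n f Byz tr' b c \<or> Content p k \<in> knowledge n f Byz tr' b"
  shows "card {q \<in> {1..n} - Byz. brb_delivered tr' q c} \<ge> n - 2 * f"
proof (rule ccontr)
  define D where "D = {q \<in> {1..n} - Byz. brb_delivered tr' q c}"
  define A where "A = Byz \<union> D"
  assume "\<not> ?thesis"
  then have "card D < n - 2 * f" by (simp add: D_def)
  moreover have "card A \<le> card Byz + card D" unfolding A_def by (rule card_Un_le)
  ultimately have card_A: "card A < n - f" using assms(1,3) by linarith
  have fin_A: "finite A"
    using finite_subset[OF assms(2)] by (simp add: A_def D_def)
  have run': "tr' \<in> runs n f Byz" using assms(4,8) by (rule runs_prefix_closed)
  \<comment> \<open>\<open>brb_delivered\<close> does not bound the process; this bound is what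
    places every deliverer in \<open>Byz\<close> or \<open>D\<close>.\<close>
  have deliverer: "q \<in> {1..n}" if "BRB_Deliver q q' j x \<in> set tr'" for q q' j x
    using run' that by (induction rule: runs.induct) auto
  have events: "guarded A p k c (payload e)" if "e \<in> set tr'" for e
  proof (rule guarded_runs[OF run' _ _ fin_A card_A _ _ that])
    \<comment> \<open>The broadcast of \<open>c\<close> may come only after \<open>tr'\<close>, so
      uniqueness is applied in \<open>tr\<close>.\<close>
    show "c' = c" if "BRB_Broadcast p k c' \<in> set tr'" for c'
      using that set_mono_prefix[OF assms(8)] broadcast_unique[OF assms(4,6)] by blast
    show "q \<in> A" if "brb_delivered tr' q c" for q
      using that deliverer by (auto simp: A_def D_def brb_delivered_def)
  qed (use assms(5) in \<open>auto simp: A_def\<close>)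
  have known: "guarded A p k c x" if "x \<in> knowledge n f Byz tr' b" for x
    using that assms(7) _ _ fin_A card_A events
    by (rule guarded_knowledge) (use assms(5) in \<open>auto simp: A_def\<close>)
  from assms(9) show False
  proof
    assume "can_decrypt n f Byz tr' b c"
    then obtain S where "n - f \<le> card S" and "\<forall>i\<in>S. DecShare i c \<in> knowledge n f Byz tr' b"
      unfolding can_decrypt_def by blast
    moreover from this have "S \<subseteq> A" using known by fastforce
    ultimately show False using card_mono[OF fin_A] card_A by fastforce
  next
    assume "Content p k \<in> knowledge n f Byz tr' b"
    from known[OF this] show False by simp
  qed
qed

end
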